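(* For all $n$ such that $K_n$ contains the relevant graph: (a) ${\mathcal M}_{f_{1,1}}(K_n)$ is the unique maximal $K_3$-matroid on $K_n$ and its rank function is ${\rm val}_{K_3}$; (b) ${\mathcal M}_{f_{2,3}}(K_n)$ is the unique maximal $K_4$-matroid on $K_n$ and its rank function is ${\rm val}_{K_4}$; (c) ${\mathcal M}_{f_{1,0}}(K_n)$ is the unique maximal $K_4^-$-matroid on $K_n$ and its rank function is ${\rm val}_{K_4^-}$; (d) ${\mathcal M}_{f_{2,2}}(K_n)$ is the unique maximal $K_5^-$-matroid on $K_n$ and its rank function is ${\rm val}_{K_5^-}$; (e) ${\mathcal M}_{f_{3,5}}(K_n)$ is the unique maximal $K_6^-$-matroid on $K_n$ and its rank function is ${\rm val}_{K_6^-}$.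
   Context: For integers $a\ge0$, $b$, let $f_{a,b}(F)=a|V(F)|-b$ for $F\subseteq E(K_n)$, where $V(F)$ is the set of vertices incident to $F$. ${\mathcal M}_{f_{a,b}}(K_n)$ is the matroid on $E(K_n)$ whose independent sets are those $F$ with $|I|\le f_{a,b}(I)$ for every nonempty $I\subseteq F$ (Edmonds' matroid induced by a non-decreasing submodular function). $K_m^-$ is $K_m$ minus one edge. An $H$-matroid on $K_n$ is a matroid on $E(K_n)$ in which the edge set of every subgraph isomorphic to $H$ is a circuit; maximality is in the weak order (${\mathcal M}_1\preceq{\mathcal M}_2$ if every independent set of ${\mathcal M}_1$ is independent in ${\mathcal M}_2$). For ${\mathcal X}$ the family of edge sets of copies of $H$ in $K_n$, a proper ${\mathcal X}$-sequence is $(X_1,\dots,X_m)$ in ${\mathcal X}$ with $X_i\not\subseteq\bigcup_{j<i}X_j$ for $i\ge2$; ${\rm val}(F,{\mathcal S})=|F\cup\bigcup_iX_i|-m$ and ${\rm val}_H(F)=\min_{\mathcal S}{\rm val}(F,{\mathcal S})$. *)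

theory Defs
  imports Main
begin

section \<open>Matroids\<close>

locale matroid =
  fixes carrier :: "'a set" and indep :: "'a set \<Rightarrow> bool"
  assumes carrier_finite: "finite carrier"
    and indep_subset_carrier: "indep X \<Longrightarrow> X \<subseteq> carrier"
    and indep_empty: "indep {}"
    and indep_subset: "indep X \<Longrightarrow> Y \<subseteq> X \<Longrightarrow> indep Y"
    and indep_augment: "indep X \<Longrightarrow> indep Y \<Longrightarrow> card Y < card X \<Longrightarrow> \<exists>x\<in>X - Y. indep (insert x Y)"

definition is_circuit :: "'a set \<Rightarrow> ('a set \<Rightarrow> bool) \<Rightarrow> 'a set \<Rightarrow> bool" where
  "is_circuit E indep C \<longleftrightarrow> C \<subseteq> E \<and> \<not> indep C \<and> (\<forall>D. D \<subset> C \<longrightarrow> indep D)"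

definition matroid_rank :: "('a set \<Rightarrow> bool) \<Rightarrow> 'a set \<Rightarrow> nat" where
  "matroid_rank indep F = Max {card I | I. I \<subseteq> F \<and> indep I}"

definition weak_le :: "('a set \<Rightarrow> bool) \<Rightarrow> ('a set \<Rightarrow> bool) \<Rightarrow> bool" where
  "weak_le indep\<^sub>1 indep\<^sub>2 \<longleftrightarrow> (\<forall>X. indep\<^sub>1 X \<longrightarrow> indep\<^sub>2 X)"


section \<open>Graphs\<close>

text \<open>A simple graph is a pair of a vertex set and a set of two-element subsets of it.\<close>

type_synonym 'v graph = "'v set \<times> 'v set set"

definition verts :: "'v graph \<Rightarrow> 'v set" where "verts G = fst G"

definition edges :: "'v graph \<Rightarrow> 'v set set" where "edges G = snd G"

definition complete_graph :: "nat \<Rightarrow> nat graph" where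
  "complete_graph n = ({..<n}, {{u, v} | u v. u < n \<and> v < n \<and> u \<noteq> v})"

definition complete_graph_minus_edge :: "nat \<Rightarrow> nat graph" where
  "complete_graph_minus_edge m =
     (verts (complete_graph m), edges (complete_graph m) - {{0, 1}})"

definition simple_graph :: "'v graph \<Rightarrow> bool" where
  "simple_graph G \<longleftrightarrow> (\<forall>e\<in>edges G. e \<subseteq> verts G \<and> card e = 2)"

definition subgraph :: "'v graph \<Rightarrow> 'v graph \<Rightarrow> bool" where
  "subgraph G' G \<longleftrightarrow> simple_graph G' \<and> verts G' \<subseteq> verts G \<and> edges G' \<subseteq> edges G"

definition graph_isomorphic :: "'v graph \<Rightarrow> 'w graph \<Rightarrow> bool" where
  "graph_isomorphic G H \<longleftrightarrow>
     (\<exists>\<phi>. bij_betw \<phi> (verts G) (verts H) \<and> edges H = (\<lambda>e. \<phi> ` e) ` edges G)"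

definition copies :: "nat graph \<Rightarrow> nat \<Rightarrow> nat set set set" where
  "copies H n = {edges G | G. subgraph G (complete_graph n) \<and> graph_isomorphic H G}"


section \<open>Maximal matroids with prescribed circuits\<close>

definition H_matroid :: "nat graph \<Rightarrow> nat \<Rightarrow> (nat set set \<Rightarrow> bool) \<Rightarrow> bool" where
  "H_matroid H n M \<longleftrightarrow> matroid (edges (complete_graph n)) M \<and>
     (\<forall>X\<in>copies H n. is_circuit (edges (complete_graph n)) M X)"

definition maximal_H_matroid :: "nat graph \<Rightarrow> nat \<Rightarrow> (nat set set \<Rightarrow> bool) \<Rightarrow> bool" where
  "maximal_H_matroid H n M \<longleftrightarrow> H_matroid H n M \<and>
     (\<forall>M'. H_matroid H n M' \<and> weak_le M M' \<longrightarrow> M' = M)"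

definition unique_maximal_H_matroid :: "nat graph \<Rightarrow> nat \<Rightarrow> (nat set set \<Rightarrow> bool) \<Rightarrow> bool" where
  "unique_maximal_H_matroid H n M \<longleftrightarrow> maximal_H_matroid H n M \<and>
     (\<forall>M'. maximal_H_matroid H n M' \<longrightarrow> M' = M)"


section \<open>The count matroids\<close>

text \<open>The set of vertices incident to \<open>F\<close> is \<open>\<Union>F\<close>.\<close>

definition f_count :: "int \<Rightarrow> int \<Rightarrow> nat set set \<Rightarrow> int" where
  "f_count a b F = a * int (card (\<Union>F)) - b"

definition count_matroid :: "int \<Rightarrow> int \<Rightarrow> nat \<Rightarrow> nat set set \<Rightarrow> bool" where
  "count_matroid a b n F \<longleftrightarrow> F \<subseteq> edges (complete_graph n) \<and>
     (\<forall>I. I \<noteq> {} \<and> I \<subseteq> F \<longrightarrow> int (card I) \<le> f_count a b I)"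


section \<open>Proper sequences\<close>

text \<open>Sequences are lists, indexed from 0, so the condition for \<open>i \<ge> 2\<close> concerns the list indices
  \<open>1 \<le> i\<close>. The empty sequence is proper and has \<open>val F [] = |F|\<close>. The minimum below is over a
  finite set: the union of a proper sequence of edge sets in a finite graph grows at each step,
  which bounds the length.\<close>

definition proper_seq :: "'a set set \<Rightarrow> 'a set list \<Rightarrow> bool" where
  "proper_seq \<X> S \<longleftrightarrow> set S \<subseteq> \<X> \<and>
     (\<forall>i. 1 \<le> i \<and> i < length S \<longrightarrow> \<not> S ! i \<subseteq> (\<Union>j<i. S ! j))"

definition seq_val :: "'a set \<Rightarrow> 'a set list \<Rightarrow> int" where
  "seq_val F S = int (card (F \<union> \<Union>(set S))) - int (length S)"

definition val_H :: "nat graph \<Rightarrow> nat \<Rightarrow> nat set set \<Rightarrow> int" where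
  "val_H H n F = Min {seq_val F S | S. proper_seq (copies H n) S}"

definition rank_function_is :: "nat \<Rightarrow> (nat set set \<Rightarrow> bool) \<Rightarrow> (nat set set \<Rightarrow> int) \<Rightarrow> bool" where
  "rank_function_is n M r \<longleftrightarrow>
     (\<forall>F. F \<subseteq> edges (complete_graph n) \<longrightarrow> int (matroid_rank M F) = r F)"

end

theory Submission
  imports Defs
begin

text \<open>
  Each circuit in a proper sequence \<open>S\<close> lowers the rank of the union by one, so every set that is
  independent in some \<open>H\<close>-matroid satisfies \<open>|F| \<le> val(F, S)\<close>. Everything therefore follows once
  each \<open>F\<close> admits a sequence with \<open>val(F, S) = |B|\<close>, where \<open>B\<close> is a basis of \<open>F\<close> in the count
  matroid. Call a vertex set \<open>V\<close> tight if \<open>B\<close> has exactly \<open>a|V| - b\<close> edges inside \<open>V\<close>. Because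
  \<open>b < 2a\<close>, two tight sets sharing an edge have a tight union, so the complete graphs on the
  maximal tight sets are edge-disjoint, and they cover \<open>F - B\<close>; those with fewer vertices than
  \<open>H\<close> lie inside \<open>B\<close> and can be discarded. For the others, \<open>K(V)\<close> is the union of a
  proper sequence of \<open>|K(V)| - (a|V| - b)\<close> copies of \<open>H\<close>, obtained by adding vertices one at a
  time: the first copy through a new vertex contributes \<open>a + 1\<close> new edges, and each later one a
  single new edge.
\<close>

section \<open>Complete graphs and their copies\<close>

definition all_edges :: "'v set \<Rightarrow> 'v set set" where
  "all_edges V = {e. e \<subseteq> V \<and> card e = 2}"

definition star :: "'v \<Rightarrow> 'v set \<Rightarrow> 'v set set" where
  "star v T = (\<lambda>w. {v, w}) ` T"

lemma verts_Pair [simp]: "verts (V, E) = V"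
  by (simp add: verts_def)

lemma edges_Pair [simp]: "edges (V, E) = E"
  by (simp add: edges_def)

lemma edges_complete_graph: "edges (complete_graph n) = all_edges {..<n}"
  by (auto simp: edges_def complete_graph_def all_edges_def card_2_iff)

lemma verts_complete_graph: "verts (complete_graph n) = {..<n}"
  by (simp add: verts_def complete_graph_def)

lemma finite_all_edges: "finite V \<Longrightarrow> finite (all_edges V)"
  by (simp add: all_edges_def)

lemma card_all_edges: "finite V \<Longrightarrow> card (all_edges V) = card V choose 2"
  by (simp add: all_edges_def n_subsets)

lemma all_edges_mono: "V \<subseteq> W \<Longrightarrow> all_edges V \<subseteq> all_edges W"
  by (auto simp: all_edges_def)

lemma all_edges_insert:
  assumes "v \<notin> V"
  shows "all_edges (insert v V) = all_edges V \<union> star v V"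
proof
  show "all_edges (insert v V) \<subseteq> all_edges V \<union> star v V"
  proof
    fix e assume e: "e \<in> all_edges (insert v V)"
    then obtain x y where xy: "e = {x, y}" "x \<noteq> y"
      by (auto simp: all_edges_def card_2_iff)
    with e show "e \<in> all_edges V \<union> star v V"
      by (auto simp: all_edges_def star_def)
  qed
  show "all_edges V \<union> star v V \<subseteq> all_edges (insert v V)"
    using assms by (auto simp: all_edges_def star_def card_2_iff)
qed

section \<open>Isomorphic copies inside the complete graph\<close>

lemma image_all_edges:
  assumes "bij_betw \<phi> V W"
  shows "(\<lambda>e. \<phi> ` e) ` all_edges V = all_edges W"
proof
  have inj: "inj_on \<phi> V" and im: "\<phi> ` V = W"
    using assms by (auto simp: bij_betw_def)
  show "(\<lambda>e. \<phi> ` e) ` all_edges V \<subseteq> all_edges W"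
    using inj im by (auto simp: all_edges_def card_image inj_on_subset)
  show "all_edges W \<subseteq> (\<lambda>e. \<phi> ` e) ` all_edges V"
  proof
    fix e assume e: "e \<in> all_edges W"
    then obtain d where d: "d \<subseteq> V" "e = \<phi> ` d"
      using im by (auto simp: all_edges_def subset_image_iff)
    moreover have "card d = card e"
      using d inj by (metis card_image inj_on_subset)
    ultimately show "e \<in> (\<lambda>e. \<phi> ` e) ` all_edges V"
      using e by (auto simp: all_edges_def)
  qed
qed

lemma copies_complete_graph:
  "copies (complete_graph m) n = {all_edges V | V. V \<subseteq> {..<n} \<and> card V = m}"
proof (intro equalityI subsetI)
  fix X assume "X \<in> copies (complete_graph m) n"
  then obtain G \<phi> where G: "X = edges G" "subgraph G (complete_graph n)"
    "bij_betw \<phi> {..<m} (verts G)" "edges G = (\<lambda>e. \<phi> ` e) ` all_edges {..<m}"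
    by (auto simp: copies_def graph_isomorphic_def edges_complete_graph verts_complete_graph)
  moreover have "card (verts G) = m"
    using bij_betw_same_card[OF G(3)] by simp
  ultimately show "X \<in> {all_edges V | V. V \<subseteq> {..<n} \<and> card V = m}"
    by (auto simp: image_all_edges subgraph_def verts_complete_graph)
next
  fix X assume "X \<in> {all_edges V | V. V \<subseteq> {..<n} \<and> card V = m}"
  then obtain V where V: "X = all_edges V" "V \<subseteq> {..<n}" "card V = m"
    by auto
  then have "finite V"
    using finite_subset by blast
  then obtain \<phi> where "bij_betw \<phi> {..<m} V"
    using V finite_same_card_bij[of "{..<m}" V] by auto
  then have "graph_isomorphic (complete_graph m) (V, X)"
    using V(1) image_all_edges[of \<phi> "{..<m}" V] unfolding graph_isomorphic_def
    by (intro exI[of _ \<phi>]) (simp add: edges_complete_graph verts_complete_graph)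
  moreover have "subgraph (V, X) (complete_graph n)"
    using V all_edges_mono[OF V(2)]
    by (auto simp: subgraph_def simple_graph_def edges_complete_graph verts_complete_graph
        all_edges_def)
  ultimately show "X \<in> copies (complete_graph m) n"
    by (auto simp: copies_def intro!: exI[of _ V] exI[of _ X])
qed

text \<open>Although the pattern omits the fixed edge \<open>{0, 1}\<close>, a bijection can send 0
  and 1 to the ends of any chosen edge. The later constructions rely on this freedom to choose which
  edge a copy omits.\<close>

lemma copies_complete_graph_minus_edge:
  assumes "2 \<le> m"
  shows "copies (complete_graph_minus_edge m) n =
    {all_edges V - {e} | V e. V \<subseteq> {..<n} \<and> card V = m \<and> e \<in> all_edges V}"
    (is "_ = ?R")
proof (intro equalityI subsetI)
  have ed: "edges (complete_graph_minus_edge m) = all_edges {..<m} - {{0, 1}}"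
    and ve: "verts (complete_graph_minus_edge m) = {..<m}"
    by (simp_all add: complete_graph_minus_edge_def edges_complete_graph verts_complete_graph)
  have e01: "{0, 1} \<in> all_edges {..<m}"
    using assms by (auto simp: all_edges_def)
  have img: "(\<lambda>e. \<phi> ` e) ` (all_edges {..<m} - {{0, 1}}) = all_edges V - {{\<phi> 0, \<phi> 1}}"
    if "bij_betw \<phi> {..<m} V" for \<phi> :: "nat \<Rightarrow> nat" and V
  proof -
    \<comment> \<open>Injectivity on whole vertex subsets ensures that deleting one edge before
      applying the map deletes exactly one edge afterwards.\<close>
    have "inj_on (\<lambda>e. \<phi> ` e) (Pow {..<m})"
      using that by (auto simp: bij_betw_def intro: inj_on_image_Pow)
    then have "inj_on (\<lambda>e. \<phi> ` e) (all_edges {..<m})"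
      by (rule inj_on_subset) (auto simp: all_edges_def)
    then show ?thesis
      using e01 image_all_edges[OF that]
      by (subst inj_on_image_set_diff[of _ "all_edges {..<m}"]) auto
  qed
  fix X
  {
    assume "X \<in> copies (complete_graph_minus_edge m) n"
    then obtain G \<phi> where G: "X = edges G" "subgraph G (complete_graph n)"
      and \<phi>: "bij_betw \<phi> {..<m} (verts G)"
      and E: "edges G = (\<lambda>e. \<phi> ` e) ` (all_edges {..<m} - {{0, 1}})"
      by (auto simp: copies_def graph_isomorphic_def ed ve)
    have "card (verts G) = m"
      using bij_betw_same_card[OF \<phi>] by simp
    moreover have "{\<phi> 0, \<phi> 1} \<in> all_edges (verts G)"
      using imageI[OF e01, of "\<lambda>e. \<phi> ` e"] image_all_edges[OF \<phi>] by auto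
    moreover have "verts G \<subseteq> {..<n}"
      using G by (auto simp: subgraph_def verts_complete_graph)
    moreover have "X = all_edges (verts G) - {{\<phi> 0, \<phi> 1}}"
      using G(1) E img[OF \<phi>] by simp
    ultimately show "X \<in> ?R"
      by blast
  next
    assume "X \<in> ?R"
    then obtain V e where V: "X = all_edges V - {e}" "V \<subseteq> {..<n}" "card V = m"
      and e: "e \<in> all_edges V"
      by auto
    have fin: "finite V"
      using V finite_subset by blast
    obtain x y where xy: "e = {x, y}" "x \<noteq> y" "x \<in> V" "y \<in> V"
      using e by (auto simp: all_edges_def card_2_iff)
    have "card (V - {x, y}) = card ({..<m} - {0, 1})"
      using xy V assms fin by (auto simp: card_Diff_subset)
    then obtain g where g: "bij_betw g ({..<m} - {0, 1}) (V - {x, y})"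
      using finite_same_card_bij[of "{..<m} - {0, 1}" "V - {x, y}"] fin by auto
    define \<phi> where "\<phi> = (\<lambda>i. if i = 0 then x else if i = 1 then y else g i)"
    have "bij_betw \<phi> ({..<m} - {0, 1}) (V - {x, y})"
      using g by (rule bij_betw_cong[THEN iffD1, rotated]) (auto simp: \<phi>_def)
    moreover have "bij_betw \<phi> {0, 1} {x, y}"
      using xy by (auto simp: bij_betw_def \<phi>_def)
    ultimately have "bij_betw \<phi> ({0, 1} \<union> ({..<m} - {0, 1})) ({x, y} \<union> (V - {x, y}))"
      by (intro bij_betw_combine) auto
    moreover have "{0, 1} \<union> ({..<m} - {0, 1}) = {..<m}" "{x, y} \<union> (V - {x, y}) = V"
      using assms xy by auto
    ultimately have \<phi>: "bij_betw \<phi> {..<m} V"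
      by simp
    have "{\<phi> 0, \<phi> 1} = e"
      by (simp add: \<phi>_def xy)
    then have "graph_isomorphic (complete_graph_minus_edge m) (V, X)"
      using V(1) \<phi> img[OF \<phi>] unfolding graph_isomorphic_def
      by (intro exI[of _ \<phi>]) (simp add: ed ve)
    moreover have "subgraph (V, X) (complete_graph n)"
      using V all_edges_mono[OF V(2)]
      by (auto simp: subgraph_def simple_graph_def edges_complete_graph verts_complete_graph
          all_edges_def)
    ultimately show "X \<in> copies (complete_graph_minus_edge m) n"
      by (auto simp: copies_def intro!: exI[of _ V] exI[of _ X])
  }
qed

section \<open>Proper sequences\<close>

lemma proper_seq_snoc:
  assumes "proper_seq \<X> (S @ [X])"
  shows "proper_seq \<X> S" "X \<in> \<X>" "S \<noteq> [] \<Longrightarrow> \<not> X \<subseteq> \<Union>(set S)"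
proof -
  have nth: "\<not> (S @ [X]) ! i \<subseteq> (\<Union>j<i. (S @ [X]) ! j)" if "1 \<le> i" "i < Suc (length S)" for i
    using assms that by (auto simp: proper_seq_def)
  show "proper_seq \<X> S"
    unfolding proper_seq_def
  proof (intro conjI allI impI)
    show "set S \<subseteq> \<X>" using assms by (auto simp: proper_seq_def)
    fix i assume i: "1 \<le> i \<and> i < length S"
    have "(\<Union>j<i. (S @ [X]) ! j) = (\<Union>j<i. S ! j)"
      using i by (intro SUP_cong) (auto simp: nth_append)
    then show "\<not> S ! i \<subseteq> (\<Union>j<i. S ! j)"
      using nth[of i] i by (auto simp: nth_append)
  qed
  show "X \<in> \<X>"
    using assms by (auto simp: proper_seq_def)
  assume "S \<noteq> []"
  moreover have "(\<Union>j<length S. (S @ [X]) ! j) = \<Union>(set S)"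
    by (auto simp: nth_append set_conv_nth)
  ultimately show "\<not> X \<subseteq> \<Union>(set S)"
    using nth[of "length S"] by (simp add: Suc_le_eq)
qed

lemma proper_seq_snocI:
  assumes "proper_seq \<X> S" "X \<in> \<X>" "\<not> X \<subseteq> \<Union>(set S)"
  shows "proper_seq \<X> (S @ [X])"
  unfolding proper_seq_def
proof (intro conjI allI impI)
  show "set (S @ [X]) \<subseteq> \<X>" using assms by (auto simp: proper_seq_def)
  fix i assume i: "1 \<le> i \<and> i < length (S @ [X])"
  have eq: "(\<Union>j<i. (S @ [X]) ! j) = (\<Union>j<i. S ! j)"
    using i by (intro SUP_cong) (auto simp: nth_append)
  show "\<not> (S @ [X]) ! i \<subseteq> (\<Union>j<i. (S @ [X]) ! j)"
  proof (cases "i = length S")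
    case True
    then have "(\<Union>j<i. S ! j) = \<Union>(set S)"
      by (auto simp: set_conv_nth)
    with True eq assms(3) show ?thesis by simp
  next
    case False
    then show ?thesis
      unfolding eq using i assms(1) by (auto simp: proper_seq_def nth_append)
  qed
qed

text \<open>An arbitrary starting set lets runs be concatenated, and keeping only the union and the
  number of copies avoids list indices. Every copy, including the first, must bring a new element;
  this is stricter than \<open>proper_seq\<close>, so a run from the empty set yields a proper
  sequence.\<close>

inductive reaches :: "'a set set \<Rightarrow> 'a set \<Rightarrow> 'a set \<Rightarrow> nat \<Rightarrow> bool" for \<X> U where
  refl: "reaches \<X> U U 0"
| step: "reaches \<X> U W k \<Longrightarrow> X \<in> \<X> \<Longrightarrow> \<not> X \<subseteq> W \<Longrightarrow> reaches \<X> U (W \<union> X) (Suc k)"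

lemma reaches_trans:
  assumes "reaches \<X> V W l" "reaches \<X> U V k"
  shows "reaches \<X> U W (k + l)"
  using assms
  by (induction rule: reaches.induct) (auto intro: reaches.intros)

text \<open>The new element that a copy brings lies in \<open>W\<close>, hence outside
  \<open>D\<close>, so having \<open>D\<close> already present does not spoil properness. This is
  how runs for edge-disjoint blocks are put one after the other.\<close>

lemma reaches_Un_disjoint:
  assumes "reaches \<X> U W k" "W \<inter> D = {}"
  shows "reaches \<X> (D \<union> U) (D \<union> W) k"
  using assms
proof (induction rule: reaches.induct)
  case refl
  show ?case by (rule reaches.refl)
next
  case (step W k X)
  then have "reaches \<X> (D \<union> U) (D \<union> W \<union> X) (Suc k)"
    by (intro reaches.step) auto
  then show ?case by (simp add: Un_assoc)
qed

lemma reaches_imp_proper_seq: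
  assumes "reaches \<X> {} W k"
  shows "\<exists>S. proper_seq \<X> S \<and> \<Union>(set S) = W \<and> length S = k"
  using assms
proof (induction rule: reaches.induct)
  case refl
  show ?case by (intro exI[of _ "[]"]) (simp add: proper_seq_def)
next
  case (step W k X)
  then obtain S where "proper_seq \<X> S" "\<Union>(set S) = W" "length S = k"
    by auto
  with step show ?case
    by (intro exI[of _ "S @ [X]"]) (auto intro: proper_seq_snocI)
qed

section \<open>Proper sequences of circuits bound independent sets\<close>

context matroid
begin

text \<open>Induction on the sequence: a circuit \<open>X\<close> not contained in the earlier union
  \<open>U\<close> adds \<open>card (X - U)\<close> elements but at most one less to the rank, since
  some maximum independent set of \<open>U \<union> X\<close> omits an element of
  \<open>X - U\<close>.\<close>

lemma indep_card_le_seq_union: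
  assumes "proper_seq \<X> S" "\<forall>X\<in>\<X>. is_circuit carrier indep X" "indep I" "I \<subseteq> \<Union>(set S)"
  shows "int (card I) \<le> int (card (\<Union>(set S))) - int (length S)"
  using assms
proof (induction S arbitrary: I rule: rev_induct)
  case Nil
  then show ?case by simp
next
  case (snoc X S)
  define U where "U = \<Union>(set S)"
  have S: "proper_seq \<X> S" "X \<in> \<X>" "S \<noteq> [] \<Longrightarrow> \<not> X \<subseteq> U"
    using proper_seq_snoc[OF snoc.prems(1)] by (auto simp: U_def)
  have circ: "is_circuit carrier indep X"
    using S snoc.prems by auto
  then have "X \<noteq> {}"
    using indep_empty by (auto simp: is_circuit_def)
  \<comment> \<open>Properness leaves the first term unconstrained; there \<open>U\<close> is empty
    and a circuit is not.\<close>
  with S(3) have "\<not> X \<subseteq> U"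
    by (cases S) (auto simp: U_def)
  then obtain e where e: "e \<in> X" "e \<notin> U" by auto
  have "\<Union>(set S) \<subseteq> carrier"
    using S(1) snoc.prems(2) by (fastforce simp: proper_seq_def is_circuit_def)
  then have finU: "finite U" and finX: "finite X"
    using circ carrier_finite by (auto simp: U_def is_circuit_def intro: finite_subset)
  \<comment> \<open>Retaining \<open>X - {e}\<close> keeps \<open>e\<close> out of every member, as
    otherwise the circuit \<open>X\<close> would be contained in an independent set. By augmentation
    a largest member is still at least as large as \<open>I\<close>.\<close>
  define \<J> where "\<J> = {J. J \<subseteq> U \<union> X \<and> indep J \<and> X - {e} \<subseteq> J}"
  have "\<J> \<subseteq> Pow (U \<union> X)" by (auto simp: \<J>_def)
  then have "finite \<J>"
    using finU finX by (meson finite_Pow_iff finite_Un finite_subset)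
  moreover have "X - {e} \<in> \<J>"
    using circ e by (auto simp: \<J>_def is_circuit_def)
  ultimately obtain J where J: "J \<in> \<J>" "\<And>J'. J' \<in> \<J> \<Longrightarrow> card J' \<le> card J"
    using obtains_MAX[of \<J> card] by (metis Max_ge empty_iff finite_imageI imageI)
  have finJ: "finite J"
    using J finU finX by (auto simp: \<J>_def intro: finite_subset)
  have "card I \<le> card J"
  proof (rule ccontr)
    assume "\<not> card I \<le> card J"
    then obtain x where x: "x \<in> I - J" "indep (insert x J)"
      using indep_augment[of I J] snoc.prems(3) J(1) by (auto simp: \<J>_def)
    then have "insert x J \<in> \<J>"
      using J(1) snoc.prems(4) by (auto simp: \<J>_def U_def)
    from J(2)[OF this] show False
      using x finJ by simp
  qed
  also have "card J = card (J \<inter> U) + card (J - U)"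
    using finJ by (metis Int_Diff_Un Int_Diff_disjoint card_Un_disjoint finite_Diff finite_Int)
  finally have 1: "card I \<le> card (J \<inter> U) + card (J - U)" .
  have 2: "int (card (J \<inter> U)) \<le> int (card U) - int (length S)"
    using snoc.IH[OF S(1) snoc.prems(2), of "J \<inter> U"] J(1) indep_subset[of J "J \<inter> U"]
    by (auto simp: U_def \<J>_def)
  have "e \<notin> J"
  proof
    assume "e \<in> J"
    then have "X \<subseteq> J" using J(1) by (auto simp: \<J>_def)
    then show False
      using J(1) indep_subset circ by (auto simp: \<J>_def is_circuit_def)
  qed
  then have "J - U \<subset> X - U"
    using J(1) e by (auto simp: \<J>_def)
  then have 3: "card (J - U) < card (X - U)"
    using finX by (simp add: psubset_card_mono)
  have "card (U \<union> X) = card U + card (X - U)"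
    using finU finX by (metis Diff_disjoint Un_Diff_cancel card_Un_disjoint finite_Diff)
  with 1 2 3 show ?case
    by (simp add: U_def[symmetric] Un_commute)
qed

text \<open>Elements of \<open>I\<close> outside the union of the sequence count once on each side,
  so only the part of \<open>I\<close> inside it needs the previous bound.\<close>

lemma indep_card_le_seq_val:
  assumes "proper_seq \<X> S" "\<forall>X\<in>\<X>. is_circuit carrier indep X" "indep I"
  shows "int (card I) \<le> seq_val I S"
proof -
  define U where "U = \<Union>(set S)"
  have "U \<subseteq> carrier"
    using assms(1,2) by (fastforce simp: U_def proper_seq_def is_circuit_def)
  then have fin: "finite U" "finite I"
    using assms(3) carrier_finite indep_subset_carrier by (auto intro: finite_subset)
  have "int (card (I \<inter> U)) \<le> int (card U) - int (length S)"
    using indep_card_le_seq_union[OF assms(1,2), of "I \<inter> U"] indep_subset[OF assms(3)]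
    by (auto simp: U_def)
  moreover have "card I = card (I \<inter> U) + card (I - U)"
    using fin by (metis Int_Diff_Un Int_Diff_disjoint card_Un_disjoint finite_Diff finite_Int)
  moreover have "card (I \<union> U) = card U + card (I - U)"
    using fin by (metis Diff_disjoint Un_Diff_cancel Un_commute card_Un_disjoint finite_Diff)
  ultimately show ?thesis
    by (simp add: seq_val_def U_def)
qed

end

section \<open>Count matroids\<close>

locale count_params =
  fixes a b :: int and n :: nat
  assumes a_pos: "1 \<le> a" and b_less: "b < 2 * a"
begin

abbreviation "sparse \<equiv> count_matroid a b n"

definition tight :: "nat set set \<Rightarrow> nat set \<Rightarrow> bool" where
  "tight Y V \<longleftrightarrow> V \<subseteq> {..<n} \<and> 2 \<le> card V \<and>
     int (card (Y \<inter> all_edges V)) = a * int (card V) - b"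

text \<open>For sparse \<open>Y\<close>, with \<open>a = b = 1\<close> these are the vertex sets of
  the components of a forest that have an edge; with \<open>a = 2\<close> and \<open>b = 3\<close>
  they are those of the rigid components of a planar framework.\<close>

definition blocks :: "nat set set \<Rightarrow> nat set set" where
  "blocks Y = {V. tight Y V \<and> (\<forall>W. tight Y W \<and> V \<subseteq> W \<longrightarrow> W = V)}"

text \<open>Strict positivity over the integers makes a single edge independent and lets a vertex
  set without edges obey the count, a case the independence condition does not cover.\<close>

lemma bound_nonneg: "2 \<le> k \<Longrightarrow> 0 < a * int k - b"
proof -
  assume "2 \<le> k"
  then have "a * 2 \<le> a * int k"
    using a_pos by (intro mult_left_mono) auto
  with b_less show ?thesis by linarith
qed

section \<open>Sparse edge sets and tight vertex sets\<close>

lemma sparse_finite: "sparse Y \<Longrightarrow> finite Y"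
  by (rule finite_subset[of _ "all_edges {..<n}"])
    (simp_all add: count_matroid_def edges_complete_graph finite_all_edges)

lemma sparse_subset: "sparse Y \<Longrightarrow> Z \<subseteq> Y \<Longrightarrow> sparse Z"
  unfolding count_matroid_def by blast

text \<open>Independence bounds the edges by the vertices they actually meet; since \<open>a\<close>
  is positive, counting all of \<open>V\<close> only weakens the bound.\<close>

lemma sparse_inside:
  assumes "sparse Y" "finite V" "2 \<le> card V"
  shows "int (card (Y \<inter> all_edges V)) \<le> a * int (card V) - b"
proof (cases "Y \<inter> all_edges V = {}")
  case True
  then show ?thesis using bound_nonneg[OF assms(3)] by simp
next
  case False
  then have "int (card (Y \<inter> all_edges V)) \<le> a * int (card (\<Union>(Y \<inter> all_edges V))) - b"
    using assms(1) by (auto simp: count_matroid_def f_count_def)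
  also have "card (\<Union>(Y \<inter> all_edges V)) \<le> card V"
    using assms(2) by (intro card_mono) (auto simp: all_edges_def)
  then have "a * int (card (\<Union>(Y \<inter> all_edges V))) - b \<le> a * int (card V) - b"
    using a_pos by (simp add: mult_left_mono)
  finally show ?thesis .
qed

text \<open>The number of edges of \<open>Y\<close> inside a vertex set is supermodular, while
  \<open>a * card V - b\<close> is modular. Equality on \<open>V\<close> and \<open>W\<close> and
  the upper bound on the intersection therefore leave no slack on the union.\<close>

lemma tight_Un:
  assumes Y: "sparse Y" and V: "tight Y V" and W: "tight Y W" and VW: "2 \<le> card (V \<inter> W)"
  shows "tight Y (V \<union> W)"
proof -
  have fin: "finite V" "finite W"
    using V W by (auto simp: tight_def intro: finite_subset)
  note finY = sparse_finite[OF Y]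
  have c: "card V + card W = card (V \<union> W) + card (V \<inter> W)"
    using fin by (rule card_Un_Int)
  have big: "2 \<le> card (V \<union> W)"
    using V fin card_mono[of "V \<union> W" V] by (auto simp: tight_def)
  have "card (Y \<inter> all_edges V) + card (Y \<inter> all_edges W) =
      card ((Y \<inter> all_edges V) \<union> (Y \<inter> all_edges W)) +
      card ((Y \<inter> all_edges V) \<inter> (Y \<inter> all_edges W))"
    using finY by (intro card_Un_Int) auto
  also have "(Y \<inter> all_edges V) \<inter> (Y \<inter> all_edges W) = Y \<inter> all_edges (V \<inter> W)"
    by (auto simp: all_edges_def)
  also have "card ((Y \<inter> all_edges V) \<union> (Y \<inter> all_edges W)) \<le> card (Y \<inter> all_edges (V \<union> W))"
    using finY by (intro card_mono) (auto simp: all_edges_def)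
  finally have "int (card (Y \<inter> all_edges V)) + int (card (Y \<inter> all_edges W)) \<le>
      int (card (Y \<inter> all_edges (V \<union> W))) + int (card (Y \<inter> all_edges (V \<inter> W)))"
    by linarith
  moreover have "int (card (Y \<inter> all_edges (V \<inter> W))) \<le> a * int (card (V \<inter> W)) - b"
    using sparse_inside[OF Y _ VW] fin by auto
  moreover have "int (card (Y \<inter> all_edges (V \<union> W))) \<le> a * int (card (V \<union> W)) - b"
    using sparse_inside[OF Y _ big] fin by auto
  moreover have "a * int (card V) + a * int (card W) =
      a * int (card (V \<union> W)) + a * int (card (V \<inter> W))"
    using c by (metis distrib_left of_nat_add)
  ultimately have "int (card (Y \<inter> all_edges (V \<union> W))) = a * int (card (V \<union> W)) - b"
    using V W by (auto simp: tight_def)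
  then show ?thesis
    using V W big by (auto simp: tight_def)
qed

section \<open>Maximal tight sets and dependent edges\<close>

lemma finite_blocks: "finite (blocks Y)"
  by (rule finite_subset[of _ "Pow {..<n}"]) (auto simp: blocks_def tight_def)

lemma finite_edges_block: "V \<in> blocks Y \<Longrightarrow> finite (all_edges V)"
  by (intro finite_all_edges finite_subset[of V "{..<n}"]) (auto simp: blocks_def tight_def)

lemma blocks_disjoint:
  assumes "sparse Y" "V \<in> blocks Y" "W \<in> blocks Y" "V \<noteq> W"
  shows "all_edges V \<inter> all_edges W = {}"
proof (rule ccontr)
  assume "all_edges V \<inter> all_edges W \<noteq> {}"
  then obtain e where e: "e \<subseteq> V \<inter> W" "card e = 2"
    by (auto simp: all_edges_def)
  have t: "tight Y V" "tight Y W"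
    using assms by (auto simp: blocks_def)
  then have "finite (V \<inter> W)"
    by (auto simp: tight_def intro: finite_subset)
  then have "2 \<le> card (V \<inter> W)"
    using e by (metis card_mono)
  then have "tight Y (V \<union> W)"
    using tight_Un assms(1) t by auto
  then have "V \<union> W = V" "V \<union> W = W"
    using assms(2,3) by (auto simp: blocks_def)
  with assms(4) show False by auto
qed

text \<open>A violated count must involve \<open>e\<close>, and deleting \<open>e\<close> restores
  it. The remaining edges thus meet the bound with equality on the same vertices, which gives a
  tight set containing both ends of \<open>e\<close>.\<close>

lemma dependent_edge_in_block:
  assumes Y: "sparse Y" and e: "e \<in> edges (complete_graph n)" "e \<notin> Y"
    and dep: "\<not> sparse (insert e Y)"
  shows "\<exists>V\<in>blocks Y. e \<in> all_edges V"
proof -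
  have ce: "card e = 2" and en: "e \<subseteq> {..<n}"
    using e by (auto simp: edges_complete_graph all_edges_def)
  have "insert e Y \<subseteq> edges (complete_graph n)"
    using Y e(1) by (simp add: count_matroid_def)
  with dep obtain I where I: "I \<noteq> {}" "I \<subseteq> insert e Y" "f_count a b I < int (card I)"
    unfolding count_matroid_def by (meson not_le)
  have "\<not> I \<subseteq> Y"
    using I(1,3) Y unfolding count_matroid_def by (meson not_le)
  with I(2) have "e \<in> I" by auto
  define J where "J = I - {e}"
  have J: "I = insert e J" "J \<subseteq> Y" "e \<notin> J"
    using I \<open>e \<in> I\<close> by (auto simp: J_def)
  have finJ: "finite J"
    using J sparse_finite[OF Y] finite_subset by auto
  have "J \<noteq> {}"
    using I(3) J(1) bound_nonneg[of 2] ce by (auto simp: f_count_def)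
  then have le: "int (card J) \<le> a * int (card (\<Union>J)) - b"
    using Y J by (auto simp: count_matroid_def f_count_def)
  have Yn: "Y \<subseteq> all_edges {..<n}"
    using Y by (auto simp: count_matroid_def edges_complete_graph)
  have In: "\<Union>I \<subseteq> {..<n}"
    using I(2) Yn en by (fastforce simp: all_edges_def)
  then have finI: "finite (\<Union>I)"
    by (rule finite_subset) simp
  have gt: "a * int (card (\<Union>I)) - b \<le> int (card J)"
    using I(3) J finJ by (simp add: f_count_def)
  \<comment> \<open>The violated count for \<open>I\<close> and the valid one for \<open>J\<close>
    enclose \<open>card J\<close>, so removing \<open>e\<close> loses no vertex.\<close>
  have "a * int (card (\<Union>I)) \<le> a * int (card (\<Union>J))"
    using gt le by linarith
  then have "card (\<Union>I) \<le> card (\<Union>J)"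
    using a_pos by simp
  then have IJ: "\<Union>J = \<Union>I"
    using J(1) finI by (intro card_subset_eq) (auto intro: antisym card_mono)
  define V where "V = \<Union>I"
  have eV: "e \<in> all_edges V"
    using \<open>e \<in> I\<close> ce by (auto simp: V_def all_edges_def)
  have cV: "2 \<le> card V"
    using eV finI ce by (metis V_def all_edges_def card_mono mem_Collect_eq)
  have "J \<subseteq> Y \<inter> all_edges V"
    using J Yn by (auto simp: V_def all_edges_def)
  then have "card J \<le> card (Y \<inter> all_edges V)"
    using sparse_finite[OF Y] by (intro card_mono) auto
  moreover have "int (card (Y \<inter> all_edges V)) \<le> a * int (card V) - b"
    using sparse_inside[OF Y _ cV] finI by (simp add: V_def)
  ultimately have "tight Y V"
    using cV In gt by (auto simp: tight_def V_def)
  moreover have "finite {W. tight Y W}"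
    by (rule finite_subset[of _ "Pow {..<n}"]) (auto simp: tight_def)
  ultimately obtain W where "V \<subseteq> W" "tight Y W" "\<And>W'. tight Y W' \<Longrightarrow> W \<subseteq> W' \<Longrightarrow> W' = W"
    using finite_has_maximal2[of "{W. tight Y W}" V] by auto
  then have "W \<in> blocks Y" "e \<in> all_edges W"
    using eV all_edges_mono[of V W] by (auto simp: blocks_def)
  then show ?thesis ..
qed

text \<open>On each block \<open>Y\<close> has as many edges as any sparse set can have there, and
  edge-disjointness lets these comparisons be added.\<close>

lemma card_inside_blocks_le:
  assumes "sparse X" "sparse Y" "\<P> \<subseteq> blocks Y"
  shows "card (X \<inter> \<Union>(all_edges ` \<P>)) \<le> card (Y \<inter> \<Union>(all_edges ` \<P>))"
proof -
  have "finite \<P>"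
    using assms(3) finite_blocks finite_subset by auto
  then show ?thesis using assms(3)
  proof (induction \<P> rule: finite_induct)
    case empty
    then show ?case by simp
  next
    case (insert V \<P>)
    define U where "U = \<Union>(all_edges ` \<P>)"
    have "all_edges V \<inter> U = {}"
      using blocks_disjoint[OF assms(2)] insert.prems insert.hyps by (fastforce simp: U_def)
    then have eq: "card (Z \<inter> (all_edges V \<union> U)) = card (Z \<inter> all_edges V) + card (Z \<inter> U)"
      if "finite Z" for Z
      using that by (subst Int_Un_distrib, subst card_Un_disjoint) auto
    have t: "tight Y V"
      using insert.prems by (auto simp: blocks_def)
    then have "int (card (X \<inter> all_edges V)) \<le> int (card (Y \<inter> all_edges V))"
      using sparse_inside[OF assms(1), of V] by (auto simp: tight_def intro: finite_subset)
    moreover have "card (X \<inter> U) \<le> card (Y \<inter> U)"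
      using insert by (auto simp: U_def)
    ultimately show ?case
      using eq[OF sparse_finite[OF assms(1)]] eq[OF sparse_finite[OF assms(2)]]
      by (simp add: U_def)
  qed
qed

text \<open>For augmentation, suppose that no edge of \<open>X - Y\<close> can be added to
  \<open>Y\<close>. Then all these edges lie in blocks of \<open>Y\<close>; inside the blocks
  \<open>X\<close> has no more edges than \<open>Y\<close>, and outside them \<open>X\<close> is
  contained in \<open>Y\<close>.\<close>

lemma matroid_count: "matroid (edges (complete_graph n)) sparse"
proof
  show "finite (edges (complete_graph n))"
    by (simp add: edges_complete_graph finite_all_edges)
  show "X \<subseteq> edges (complete_graph n)" if "sparse X" for X
    using that by (simp add: count_matroid_def)
  show "sparse {}"
    by (simp add: count_matroid_def)
  show "sparse Y" if "sparse X" "Y \<subseteq> X" for X Y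
    using that by (rule sparse_subset)
  fix X Y assume XY: "sparse X" "sparse Y" "card Y < card X"
  show "\<exists>x\<in>X - Y. sparse (insert x Y)"
  proof (rule ccontr)
    assume no: "\<not> (\<exists>x\<in>X - Y. sparse (insert x Y))"
    define U where "U = \<Union>(all_edges ` blocks Y)"
    note fin = sparse_finite[OF XY(1)] sparse_finite[OF XY(2)]
    have "X - Y \<subseteq> U"
    proof
      fix e assume e: "e \<in> X - Y"
      then have "e \<in> edges (complete_graph n)"
        using XY(1) by (auto simp: count_matroid_def)
      then show "e \<in> U"
        using dependent_edge_in_block[OF XY(2)] no e by (auto simp: U_def)
    qed
    then have "card (X - U) \<le> card (Y - U)"
      using fin by (intro card_mono) auto
    moreover have "card (X \<inter> U) \<le> card (Y \<inter> U)"
      using card_inside_blocks_le[OF XY(1,2), of "blocks Y"] by (simp add: U_def)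
    moreover have split: "card Z = card (Z \<inter> U) + card (Z - U)" if "finite Z" for Z
      using that by (metis Int_Diff_Un Int_Diff_disjoint card_Un_disjoint finite_Diff finite_Int)
    ultimately show False
      using XY(3) split[OF fin(1)] split[OF fin(2)] by linarith
  qed
qed

end

section \<open>Count matroids generated by copies of a graph\<close>

text \<open>
  Here \<open>m\<close> is the number of vertices of \<open>H\<close>, and \<open>t = a + 1\<close> is the number of edges at a new
  vertex that the first copy of \<open>H\<close> through it contributes.
\<close>

locale count_H = count_params +
  fixes H :: "nat graph" and m t :: nat
  assumes copy_size: "X \<in> copies H n \<Longrightarrow> \<exists>V. V \<subseteq> {..<n} \<and> card V = m \<and> X \<subseteq> all_edges V \<and>
      int (card X) = a * int m - b + 1"
    and small_bound: "2 \<le> j \<Longrightarrow> j < m \<Longrightarrow> int (j choose 2) \<le> a * int j - b"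
    and t_eq: "int t = a + 1" and t_le: "t \<le> m" and m_ge: "2 \<le> m"
    and reaches_base: "V \<subseteq> {..<n} \<Longrightarrow> card V = m \<Longrightarrow>
      \<exists>k. reaches (copies H n) {} (all_edges V) k \<and> int k = int (m choose 2) - (a * int m - b)"
    and first_copy: "V \<subseteq> {..<n} \<Longrightarrow> m \<le> card V \<Longrightarrow> T \<subseteq> V \<Longrightarrow> card T = t \<Longrightarrow> v \<in> {..<n} - V \<Longrightarrow>
      \<exists>X\<in>copies H n. star v T \<subseteq> X \<and> X \<subseteq> all_edges V \<union> star v T"
    and next_copy: "V \<subseteq> {..<n} \<Longrightarrow> T \<subseteq> V \<Longrightarrow> card T = t \<Longrightarrow> w \<in> V - T \<Longrightarrow> v \<in> {..<n} - V \<Longrightarrow>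
      \<exists>X\<in>copies H n. {v, w} \<in> X \<and> X \<subseteq> all_edges V \<union> star v (insert w T)"
begin

text \<open>A copy exceeds the count on its \<open>m\<close> vertices by exactly one. A proper
  subset either still meets \<open>m\<close> vertices and has lost an edge, or lies in a smaller
  complete graph, which \<open>small_bound\<close> makes harmless.\<close>

lemma copy_is_circuit:
  assumes "X \<in> copies H n"
  shows "is_circuit (edges (complete_graph n)) sparse X"
proof -
  obtain V where V: "V \<subseteq> {..<n}" "card V = m" "X \<subseteq> all_edges V"
    and cX: "int (card X) = a * int m - b + 1"
    using copy_size[OF assms] by auto
  have finV: "finite V"
    using V finite_subset by auto
  have finX: "finite X"
    using V(3) finite_all_edges[OF finV] by (rule finite_subset)
  have XE: "X \<subseteq> edges (complete_graph n)"
    using V(3) all_edges_mono[OF V(1)] by (auto simp: edges_complete_graph)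
  have union_le: "card (\<Union>I) \<le> m" "finite (\<Union>I)" if "I \<subseteq> X" for I
  proof -
    have "\<Union>I \<subseteq> V"
      using that V(3) by (auto simp: all_edges_def)
    then show "card (\<Union>I) \<le> m" "finite (\<Union>I)"
      using V(2) finV card_mono finite_subset by auto
  qed
  have "\<not> sparse X"
  proof
    assume sp: "sparse X"
    then have "int (card X) \<le> a * int m - b"
      using sparse_inside[OF sp finV] V m_ge by (auto simp: Int_absorb2)
    with cX show False by simp
  qed
  moreover have "sparse D" if "D \<subset> X" for D
    unfolding count_matroid_def f_count_def
  proof (intro conjI allI impI)
    show "D \<subseteq> edges (complete_graph n)"
      using that XE by auto
    fix I assume I: "I \<noteq> {} \<and> I \<subseteq> D"
    then have IX: "I \<subset> X" using that by auto
    then have fin: "finite (\<Union>I)" and le: "card (\<Union>I) \<le> m"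
      using union_le[of I] by auto
    obtain e where "e \<in> I" using I by auto
    moreover have "card e = 2"
      using \<open>e \<in> I\<close> IX V(3) by (auto simp: all_edges_def)
    ultimately have ge: "2 \<le> card (\<Union>I)"
      using fin by (metis Union_upper card_mono)
    show "int (card I) \<le> a * int (card (\<Union>I)) - b"
    proof (cases "card (\<Union>I) = m")
      case True
      have "card I < card X"
        using IX finX by (simp add: psubset_card_mono)
      with cX True show ?thesis by simp
    next
      case False
      have "I \<subseteq> all_edges (\<Union>I)"
        using IX V(3) by (auto simp: all_edges_def)
      then have "card I \<le> card (\<Union>I) choose 2"
        using fin by (metis card_all_edges card_mono finite_all_edges)
      with False le ge small_bound[of "card (\<Union>I)"] show ?thesis
        by linarith
    qed
  qed
  ultimately show ?thesis
    using XE by (auto simp: is_circuit_def)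
qed

lemma H_matroid_count: "H_matroid H n sparse"
  by (simp add: H_matroid_def matroid_count copy_is_circuit)

text \<open>Since \<open>t = a + 1\<close>, the number of copies is \<open>card V - a\<close>: the
  new vertex brings \<open>card V\<close> edges while the count grows by \<open>a\<close>.\<close>

lemma reaches_add_vertex:
  assumes V: "V \<subseteq> {..<n}" "m \<le> card V" and v: "v \<in> {..<n} - V"
  shows "reaches (copies H n) (all_edges V) (all_edges (insert v V)) (Suc (card V - t))"
proof -
  have finV: "finite V"
    using V finite_subset by auto
  have "t \<le> card V" using V t_le by simp
  then obtain T where T: "T \<subseteq> V" "card T = t"
    by (rule obtain_subset_with_card_n)
  have new: "{v, w} \<notin> all_edges V" for w
    using v by (auto simp: all_edges_def)
  have t_pos: "0 < t"
    using t_eq a_pos by linarith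
  obtain X where X: "X \<in> copies H n" "star v T \<subseteq> X" "X \<subseteq> all_edges V \<union> star v T"
    using first_copy[OF V T v] by auto
  obtain w where "w \<in> T"
    using T t_pos by fastforce
  then have "\<not> X \<subseteq> all_edges V"
    using X(2) new by (auto simp: star_def)
  then have "reaches (copies H n) (all_edges V) (all_edges V \<union> X) (Suc 0)"
    using X(1) by (intro reaches.intros)
  moreover have "all_edges V \<union> X = all_edges V \<union> star v T"
    using X by auto
  ultimately have first: "reaches (copies H n) (all_edges V) (all_edges V \<union> star v T) (Suc 0)"
    by simp
  \<comment> \<open>The set \<open>T\<close> stays fixed while the other neighbours of
    \<open>v\<close> are attached one by one; each copy uses only old edges and its single new
    edge.\<close>
  have "reaches (copies H n) (all_edges V) (all_edges V \<union> star v (T \<union> R)) (Suc (card R))"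
    if "R \<subseteq> V - T" for R
  proof -
    have "finite R" using that finV finite_subset by auto
    then show ?thesis using that
    proof (induction R rule: finite_induct)
      case empty
      then show ?case using first by simp
    next
      case (insert w R)
      obtain X where X: "X \<in> copies H n" "{v, w} \<in> X" "X \<subseteq> all_edges V \<union> star v (insert w T)"
        using next_copy[OF V(1) T _ v, of w] insert.prems by auto
      have "{v, w} \<notin> star v (T \<union> R)"
        using insert v by (auto simp: star_def doubleton_eq_iff)
      with X(2) new have "\<not> X \<subseteq> all_edges V \<union> star v (T \<union> R)"
        by blast
      with insert X(1) have "reaches (copies H n) (all_edges V)
          (all_edges V \<union> star v (T \<union> R) \<union> X) (Suc (Suc (card R)))"
        by (intro reaches.step[where X = X]) auto
      moreover have "all_edges V \<union> star v (T \<union> R) \<union> X = all_edges V \<union> star v (T \<union> insert w R)"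
        using X by (auto simp: star_def)
      ultimately show ?case
        using insert.hyps by simp
    qed
  qed
  from this[of "V - T"] show ?thesis
    using T v finV by (simp add: all_edges_insert Un_absorb1 card_Diff_subset finite_subset)
qed

text \<open>The number \<open>k\<close> is the amount by which the complete graph on
  \<open>V\<close> exceeds the count. Adding a vertex to \<open>W\<close> raises this excess by
  \<open>card W - a\<close>, exactly the number of copies spent.\<close>

lemma reaches_all_edges:
  assumes "V \<subseteq> {..<n}" "m \<le> card V"
  shows "\<exists>k. reaches (copies H n) {} (all_edges V) k \<and>
      int k = int (card (all_edges V)) - (a * int (card V) - b)"
  using assms
proof (induction "card V - m" arbitrary: V)
  case 0
  then have "card V = m" by simp
  moreover have "finite V"
    using 0 finite_subset by auto
  ultimately show ?case
    using reaches_base[of V] 0 by (simp add: card_all_edges)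
next
  case (Suc d)
  have finV: "finite V"
    using Suc.prems finite_subset by auto
  have "V \<noteq> {}" using Suc.hyps(2) by auto
  then obtain v where v: "v \<in> V" by auto
  define W where "W = V - {v}"
  have W: "V = insert v W" "v \<notin> W" "finite W" "card V = Suc (card W)"
    using v finV card_Suc_Diff1[OF finV v] by (auto simp: W_def)
  then have "m \<le> card W" "d = card W - m" "W \<subseteq> {..<n}"
    using Suc.hyps(2) Suc.prems by auto
  then obtain k where k: "reaches (copies H n) {} (all_edges W) k"
    "int k = int (card (all_edges W)) - (a * int (card W) - b)"
    using Suc.hyps(1) by blast
  have "reaches (copies H n) {} (all_edges V) (k + Suc (card W - t))"
    using reaches_trans[OF reaches_add_vertex k(1), of v] \<open>m \<le> card W\<close> W Suc.prems by auto
  moreover have "card (all_edges V) = card (all_edges W) + card W"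
    using W finV by (simp add: card_all_edges numeral_2_eq_2)
  then have "int (k + Suc (card W - t)) = int (card (all_edges V)) - (a * int (card V) - b)"
    using k(2) t_eq t_le \<open>m \<le> card W\<close> W(4) by (simp add: of_nat_diff algebra_simps)
  ultimately show ?case by blast
qed

text \<open>On a tight \<open>V\<close> the count equals the number of edges of \<open>B\<close>
  inside, so the excess is the number of edges of the complete graph outside \<open>B\<close>.
  Disjointness of the blocks makes these numbers add up.\<close>

lemma reaches_blocks:
  assumes B: "sparse B" and "\<P> \<subseteq> blocks B" "\<And>V. V \<in> \<P> \<Longrightarrow> m \<le> card V"
  shows "reaches (copies H n) {} (\<Union>(all_edges ` \<P>)) (card (\<Union>(all_edges ` \<P>) - B))"
proof -
  have "finite \<P>"
    using assms(2) finite_blocks finite_subset by auto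
  then show ?thesis using assms(2,3)
  proof (induction \<P> rule: finite_induct)
    case empty
    then show ?case by (auto intro: reaches.refl)
  next
    case (insert V \<P>)
    define U where "U = \<Union>(all_edges ` \<P>)"
    have disj: "all_edges V \<inter> U = {}"
      using blocks_disjoint[OF B] insert.prems insert.hyps by (fastforce simp: U_def)
    have t: "tight B V"
      using insert.prems by (auto simp: blocks_def)
    then have V: "V \<subseteq> {..<n}" "finite V"
      by (auto simp: tight_def intro: finite_subset)
    have finU: "finite U"
      unfolding U_def using insert.prems insert.hyps finite_edges_block by auto
    obtain k where k: "reaches (copies H n) {} (all_edges V) k"
      "int k = int (card (all_edges V)) - (a * int (card V) - b)"
      using reaches_all_edges[OF V(1)] insert.prems by auto
    have "card (all_edges V) = card (B \<inter> all_edges V) + card (all_edges V - B)"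
      using finite_all_edges[OF V(2)]
      by (metis Int_Diff_Un Int_Diff_disjoint Int_commute card_Un_disjoint finite_Diff finite_Int)
    then have k': "k = card (all_edges V - B)"
      using k(2) t by (simp add: tight_def)
    have "reaches (copies H n) {} (U \<union> all_edges V) (card (U - B) + k)"
      using reaches_trans[OF reaches_Un_disjoint[OF k(1) disj]] insert by (auto simp: U_def)
    moreover have "card ((U \<union> all_edges V) - B) = card (U - B) + k"
      unfolding k' using disj finU finite_all_edges[OF V(2)]
      by (subst Un_Diff, subst card_Un_disjoint) auto
    ultimately show ?case
      by (simp add: U_def Un_commute)
  qed
qed

text \<open>The union \<open>U\<close> of the large blocks costs one copy per edge outside
  \<open>B\<close>. As \<open>U\<close> absorbs \<open>F - B\<close>, those edges and copies cancel
  in \<open>seq_val\<close>, leaving \<open>card B\<close>.\<close>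

lemma exists_seq_val_eq_basis:
  assumes F: "F \<subseteq> edges (complete_graph n)" and B: "B \<subseteq> F" "sparse B"
    and max: "\<And>e. e \<in> F - B \<Longrightarrow> \<not> sparse (insert e B)"
  shows "\<exists>S. proper_seq (copies H n) S \<and> seq_val F S = int (card B)"
proof -
  define \<P> where "\<P> = {V \<in> blocks B. m \<le> card V}"
  define U where "U = \<Union>(all_edges ` \<P>)"
  have finB: "finite B"
    using sparse_finite[OF B(2)] .
  have "finite (all_edges V)" if "V \<in> \<P>" for V
    using that finite_edges_block by (auto simp: \<P>_def)
  moreover have "finite \<P>"
    using finite_blocks by (simp add: \<P>_def)
  ultimately have finU: "finite U"
    by (auto simp: U_def)
  have "reaches (copies H n) {} U (card (U - B))"
    unfolding U_def by (rule reaches_blocks[OF B(2)]) (auto simp: \<P>_def)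
  then obtain S where S: "proper_seq (copies H n) S" "\<Union>(set S) = U" "length S = card (U - B)"
    using reaches_imp_proper_seq by blast
  have "F - B \<subseteq> U"
  proof
    fix e assume e: "e \<in> F - B"
    then obtain V where V: "V \<in> blocks B" "e \<in> all_edges V"
      using dependent_edge_in_block[OF B(2), of e] max F by auto
    have t: "tight B V" and finV: "finite V"
      using V by (auto simp: blocks_def tight_def intro: finite_subset)
    \<comment> \<open>In a smaller block the complete graph has no more edges than the count, so
      tightness puts all of them into \<open>B\<close>, contrary to the choice of
      \<open>e\<close>.\<close>
    have "m \<le> card V"
    proof (rule ccontr)
      assume "\<not> m \<le> card V"
      then have "int (card (all_edges V)) \<le> int (card (B \<inter> all_edges V))"
        using small_bound[of "card V"] t finV by (simp add: tight_def card_all_edges)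
      then have "B \<inter> all_edges V = all_edges V"
        using finite_all_edges[OF finV] by (intro card_seteq) auto
      with V e show False by auto
    qed
    with V show "e \<in> U" by (auto simp: U_def \<P>_def)
  qed
  then have "F \<union> U = B \<union> (U - B)"
    using B(1) by auto
  then have "card (F \<union> U) = card B + card (U - B)"
    using finB finU card_Un_disjoint[of B "U - B"] by auto
  then show ?thesis
    using S by (auto simp: seq_val_def)
qed

section \<open>Maximality and the rank formula\<close>

lemma obtain_basis:
  assumes F: "F \<subseteq> edges (complete_graph n)"
  obtains B where "B \<subseteq> F" "sparse B" "\<And>e. e \<in> F - B \<Longrightarrow> \<not> sparse (insert e B)"
    "matroid_rank sparse F = card B"
proof -
  have finF: "finite F"
    using F finite_subset finite_all_edges by (auto simp: edges_complete_graph)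
  let ?C = "{card I | I. I \<subseteq> F \<and> sparse I}"
  have fin: "finite ?C"
    by (rule finite_subset[of _ "card ` Pow F"]) (auto simp: finF)
  moreover have "sparse {}"
    by (simp add: count_matroid_def)
  then have "?C \<noteq> {}"
    by auto
  ultimately have "Max ?C \<in> ?C"
    by (rule Max_in)
  then obtain B where B: "B \<subseteq> F" "sparse B" "matroid_rank sparse F = card B"
    by (auto simp: matroid_rank_def)
  have "\<not> sparse (insert e B)" if "e \<in> F - B" for e
  proof
    assume "sparse (insert e B)"
    then have "card (insert e B) \<in> ?C"
      using that B by blast
    from Max_ge[OF fin this] have "card (insert e B) \<le> card B"
      unfolding B(3)[unfolded matroid_rank_def] .
    then show False
      using that sparse_finite[OF B(2)] by simp
  qed
  with B that show ?thesis by metis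
qed

text \<open>For a maximal sparse subset \<open>B\<close> of an \<open>M\<close>-independent
  \<open>F\<close>, the sequence attaining \<open>card B\<close> also bounds \<open>card F\<close>
  from above. Hence \<open>F = B\<close>.\<close>

lemma H_matroid_weak_le:
  assumes "H_matroid H n M"
  shows "weak_le M sparse"
  unfolding weak_le_def
proof (intro allI impI)
  fix F assume F: "M F"
  have M: "matroid (edges (complete_graph n)) M"
    "\<forall>X\<in>copies H n. is_circuit (edges (complete_graph n)) M X"
    using assms by (auto simp: H_matroid_def)
  have FE: "F \<subseteq> edges (complete_graph n)"
    using M(1) F by (rule matroid.indep_subset_carrier)
  obtain B where B: "B \<subseteq> F" "sparse B" "\<And>e. e \<in> F - B \<Longrightarrow> \<not> sparse (insert e B)"
    using obtain_basis[OF FE] by metis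
  obtain S where S: "proper_seq (copies H n) S" "seq_val F S = int (card B)"
    using exists_seq_val_eq_basis[OF FE B] by auto
  have "card F \<le> card B"
    using matroid.indep_card_le_seq_val[OF M(1) S(1) M(2) F] S(2) by simp
  moreover have "finite F"
    using FE finite_subset finite_all_edges by (auto simp: edges_complete_graph)
  ultimately have "B = F"
    using B(1) card_seteq by blast
  with B(2) show "sparse F" by simp
qed

text \<open>The count matroid is a greatest element among the \<open>H\<close>-matroids, not merely
  a maximal one, so uniqueness is immediate.\<close>

lemma unique_maximal_count: "unique_maximal_H_matroid H n sparse"
proof -
  have "maximal_H_matroid H n sparse"
    using H_matroid_count H_matroid_weak_le
    by (auto simp: maximal_H_matroid_def weak_le_def fun_eq_iff)
  moreover have "M = sparse" if "maximal_H_matroid H n M" for M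
    using that H_matroid_count H_matroid_weak_le by (auto simp: maximal_H_matroid_def)
  ultimately show ?thesis
    unfolding unique_maximal_H_matroid_def by blast
qed

lemma rank_function_count: "rank_function_is n sparse (val_H H n)"
  unfolding rank_function_is_def
proof (intro allI impI)
  fix F assume F: "F \<subseteq> edges (complete_graph n)"
  have finE: "finite (edges (complete_graph n))"
    by (simp add: edges_complete_graph finite_all_edges)
  obtain B where B: "B \<subseteq> F" "sparse B" "\<And>e. e \<in> F - B \<Longrightarrow> \<not> sparse (insert e B)"
    "matroid_rank sparse F = card B"
    using obtain_basis[OF F] by metis
  obtain S where S: "proper_seq (copies H n) S" "seq_val F S = int (card B)"
    using exists_seq_val_eq_basis[OF F B(1-3)] by auto
  have union: "F \<union> \<Union>(set S) \<subseteq> edges (complete_graph n)" if "proper_seq (copies H n) S" for S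
  proof -
    have "X \<subseteq> edges (complete_graph n)" if "X \<in> copies H n" for X
      using copy_is_circuit[OF that] by (simp add: is_circuit_def)
    with that F show ?thesis
      unfolding proper_seq_def by blast
  qed
  have lower: "int (card B) \<le> seq_val F S" if S: "proper_seq (copies H n) S" for S
  proof -
    have "int (card B) \<le> seq_val B S"
      using matroid.indep_card_le_seq_val[OF matroid_count S] copy_is_circuit B(2) by auto
    \<comment> \<open>The sequence is unchanged, so passing from \<open>B\<close> to
      \<open>F\<close> can only increase the value.\<close>
    also have "card (B \<union> \<Union>(set S)) \<le> card (F \<union> \<Union>(set S))"
      using union[OF S] finE B(1) by (intro card_mono) (auto intro: finite_subset)
    then have "seq_val B S \<le> seq_val F S"
      by (simp add: seq_val_def)
    finally show ?thesis .
  qed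
  have upper: "seq_val F S \<le> int (card (edges (complete_graph n)))"
    if "proper_seq (copies H n) S" for S
    using card_mono[OF finE union[OF that]] by (simp add: seq_val_def)
  have "val_H H n F = int (card B)"
    unfolding val_H_def
  proof (rule Min_eqI)
    \<comment> \<open>It is enough that the values lie in a bounded interval of integers; the
      sequences themselves need not be enumerated.\<close>
    show "finite {seq_val F S | S. proper_seq (copies H n) S}"
      by (rule finite_subset[of _ "{int (card B)..int (card (edges (complete_graph n)))}"])
        (auto simp: lower upper)
    show "int (card B) \<le> y" if "y \<in> {seq_val F S | S. proper_seq (copies H n) S}" for y
      using that lower by auto
    show "int (card B) \<in> {seq_val F S | S. proper_seq (copies H n) S}"
      using S by (metis (mono_tags, lifting) mem_Collect_eq)
  qed
  with B(4) show "int (matroid_rank sparse F) = val_H H n F"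
    by simp
qed

end

section \<open>The five cases\<close>

text \<open>The first copy is the complete graph on \<open>v\<close> and \<open>T\<close>; a later
  one uses \<open>v\<close>, \<open>w\<close> and all but one vertex of \<open>T\<close>. The
  numerical conditions give \<open>b = m * (m - 3) / 2 + 1\<close>, and then
  \<open>b < 2 * a\<close> leaves only \<open>m = 3\<close> and \<open>m = 4\<close>.\<close>

lemma count_H_complete_graph:
  assumes "1 \<le> a" "b < 2 * a" "3 \<le> m" "int m = a + 2"
    and size: "int (m choose 2) = a * int m - b + 1"
    and small: "\<And>j. 2 \<le> j \<Longrightarrow> j < m \<Longrightarrow> int (j choose 2) \<le> a * int j - b"
  shows "count_H a b n (complete_graph m) m (m - 1)"
proof
  show "1 \<le> a" "b < 2 * a" "int (m - 1) = a + 1" "m - 1 \<le> m" "2 \<le> m"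
    using assms by auto
  show "int (j choose 2) \<le> a * int j - b" if "2 \<le> j" "j < m" for j
    using that by (rule small)
  have copyI: "all_edges V \<in> copies (complete_graph m) n" if "V \<subseteq> {..<n}" "card V = m" for V
    using that by (auto simp: copies_complete_graph)
  show "\<exists>V. V \<subseteq> {..<n} \<and> card V = m \<and> X \<subseteq> all_edges V \<and> int (card X) = a * int m - b + 1"
    if X: "X \<in> copies (complete_graph m) n" for X
  proof -
    obtain V where V: "X = all_edges V" "V \<subseteq> {..<n}" "card V = m"
      using X by (auto simp: copies_complete_graph)
    then have "card X = m choose 2"
      by (simp add: card_all_edges finite_subset[OF V(2)])
    with V size show ?thesis by auto
  qed
  show "\<exists>k. reaches (copies (complete_graph m) n) {} (all_edges V) k \<and>
      int k = int (m choose 2) - (a * int m - b)" if V: "V \<subseteq> {..<n}" "card V = m" for V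
  proof -
    have "card (all_edges V) = m choose 2"
      using V by (simp add: card_all_edges finite_subset[OF V(1)])
    moreover have "0 < m choose 2"
      using assms(3) by (simp add: zero_less_binomial)
    ultimately have "all_edges V \<noteq> {}" by auto
    then have "reaches (copies (complete_graph m) n) {} ({} \<union> all_edges V) (Suc 0)"
      using copyI[OF V] by (intro reaches.intros) auto
    then show ?thesis using size by (intro exI[of _ "Suc 0"]) auto
  qed
  fix V T :: "nat set" and v
  assume V: "V \<subseteq> {..<n}" and T: "T \<subseteq> V" "card T = m - 1" and v: "v \<in> {..<n} - V"
  have fin: "finite V" "finite T"
    using V T by (auto intro: finite_subset)
  {
    have "v \<notin> T" using T v by auto
    then have "all_edges (insert v T) \<in> copies (complete_graph m) n"
      using T V v fin assms(3) by (intro copyI) auto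
    moreover have "all_edges (insert v T) = all_edges T \<union> star v T"
      using \<open>v \<notin> T\<close> by (rule all_edges_insert)
    ultimately show "\<exists>X\<in>copies (complete_graph m) n. star v T \<subseteq> X \<and> X \<subseteq> all_edges V \<union> star v T"
      using all_edges_mono[OF T(1)] by auto
  next
    fix w assume w: "w \<in> V - T"
    \<comment> \<open>Together with \<open>v\<close> and \<open>w\<close> the set \<open>T\<close>
      would have \<open>m + 1\<close> vertices, so one vertex of \<open>T\<close> is
      dropped.\<close>
    have "m - 2 \<le> card T" using T by simp
    then obtain T' where T': "T' \<subseteq> T" "card T' = m - 2"
      by (rule obtain_subset_with_card_n)
    let ?W = "insert w T'"
    have nw: "w \<notin> T'" "v \<notin> ?W" "?W \<subseteq> V" "finite T'"
      using w T' T v fin by (auto intro: finite_subset)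
    then have "card (insert v ?W) = m"
      using T' assms(3) by simp
    then have "all_edges (insert v ?W) \<in> copies (complete_graph m) n"
      using nw V v by (intro copyI) auto
    moreover have "all_edges (insert v ?W) = all_edges ?W \<union> star v ?W"
      using nw(2) by (rule all_edges_insert)
    ultimately show "\<exists>X\<in>copies (complete_graph m) n. {v, w} \<in> X \<and>
        X \<subseteq> all_edges V \<union> star v (insert w T)"
      using all_edges_mono[OF nw(3)] T'(1) by (intro bexI[of _ "all_edges (insert v ?W)"])
        (auto simp: star_def)
  }
qed

text \<open>Here \<open>v\<close>, \<open>T\<close> and one more vertex make up the \<open>m\<close>
  vertices of a copy, and the choice of the omitted edge decides which edges at \<open>v\<close> are
  new. The numerical conditions give \<open>b = m * (m - 5) / 2 + 2\<close>, and then
  \<open>b < 2 * a\<close> leaves only \<open>m = 4, 5, 6\<close>.\<close>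

lemma count_H_complete_graph_minus_edge:
  assumes "1 \<le> a" "b < 2 * a" "4 \<le> m" "int m = a + 3"
    and size: "int (m choose 2) = a * int m - b + 2"
    and small: "\<And>j. 2 \<le> j \<Longrightarrow> j < m \<Longrightarrow> int (j choose 2) \<le> a * int j - b"
  shows "count_H a b n (complete_graph_minus_edge m) m (m - 2)"
proof
  show "1 \<le> a" "b < 2 * a" "int (m - 2) = a + 1" "m - 2 \<le> m" "2 \<le> m"
    using assms by auto
  show "int (j choose 2) \<le> a * int j - b" if "2 \<le> j" "j < m" for j
    using that by (rule small)
  let ?X = "copies (complete_graph_minus_edge m) n"
  have copies_eq: "?X = {all_edges V - {e} | V e. V \<subseteq> {..<n} \<and> card V = m \<and> e \<in> all_edges V}"
    using assms(3) by (intro copies_complete_graph_minus_edge) simp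
  have copyI: "all_edges V - {e} \<in> ?X" if "V \<subseteq> {..<n}" "card V = m" "e \<in> all_edges V" for V e
    using that by (auto simp: copies_eq)
  show "\<exists>V. V \<subseteq> {..<n} \<and> card V = m \<and> X \<subseteq> all_edges V \<and> int (card X) = a * int m - b + 1"
    if X: "X \<in> ?X" for X
  proof -
    obtain V e where V: "X = all_edges V - {e}" "V \<subseteq> {..<n}" "card V = m" "e \<in> all_edges V"
      using X by (auto simp: copies_eq)
    have finV: "finite V" using V(2) finite_subset by auto
    have "card (all_edges V) = Suc (card X)"
      using V finite_all_edges[OF finV] by (metis card.remove)
    then have "m choose 2 = Suc (card X)"
      using V(3) finV by (simp add: card_all_edges)
    then have "int (card X) = a * int m - b + 1" using size by simp
    with V show ?thesis by blast
  qed
  show "\<exists>k. reaches ?X {} (all_edges V) k \<and>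
      int k = int (m choose 2) - (a * int m - b)" if V: "V \<subseteq> {..<n}" "card V = m" for V
  proof -
    have "3 \<le> card V" using V assms(3) by simp
    then obtain T where "T \<subseteq> V" "card T = 3"
      by (rule obtain_subset_with_card_n)
    then obtain x y z where xyz: "{x, y, z} \<subseteq> V" "x \<noteq> y" "x \<noteq> z" "y \<noteq> z"
      by (auto simp: card_3_iff)
    \<comment> \<open>The complete graph exceeds the count by two, so two copies are needed; each
      one supplies the edge that the other omits.\<close>
    define d e where "d = {x, y}" and "e = {x, z}"
    have de: "d \<in> all_edges V" "e \<in> all_edges V" "d \<noteq> e"
      using xyz by (auto simp: d_def e_def all_edges_def doubleton_eq_iff)
    have "reaches ?X {} ({} \<union> (all_edges V - {d}) \<union> (all_edges V - {e})) (Suc (Suc 0))"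
      using copyI[OF V] de by (intro reaches.intros) auto
    moreover have "{} \<union> (all_edges V - {d}) \<union> (all_edges V - {e}) = all_edges V"
      using de by auto
    ultimately show ?thesis using size by (intro exI[of _ "Suc (Suc 0)"]) auto
  qed
  fix V T :: "nat set" and v
  assume V: "V \<subseteq> {..<n}" and T: "T \<subseteq> V" "card T = m - 2" and v: "v \<in> {..<n} - V"
  have fin: "finite V" "finite T"
    using V T by (auto intro: finite_subset)
  have W: "insert v (insert w T) \<subseteq> {..<n}" "card (insert v (insert w T)) = m"
    "all_edges (insert v (insert w T)) = all_edges (insert w T) \<union> star v (insert w T)"
    "all_edges (insert w T) \<subseteq> all_edges V"
    if "w \<in> V - T" for w
  proof -
    have "v \<notin> insert w T" using that T v by auto
    then show "card (insert v (insert w T)) = m"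
      "all_edges (insert v (insert w T)) = all_edges (insert w T) \<union> star v (insert w T)"
      using that T fin assms(3) by (auto simp: all_edges_insert)
    show "insert v (insert w T) \<subseteq> {..<n}" "all_edges (insert w T) \<subseteq> all_edges V"
      using that T V v by (auto intro!: all_edges_mono del: subsetI)
  qed
  {
    assume "m \<le> card V"
    \<comment> \<open>A vertex \<open>u\<close> outside \<open>T\<close> completes the copy;
      omitting \<open>{v, u}\<close> leaves exactly the edges from \<open>v\<close> to
      \<open>T\<close> as new ones.\<close>
    then have "card T < card V" using T assms(3) by simp
    then obtain u where u: "u \<in> V - T"
      using T by (metis Diff_eq_empty_iff all_not_in_conv less_irrefl subset_antisym)
    have vu: "{v, u} \<in> star v (insert u T)" "{v, u} \<notin> all_edges V"
      using v by (auto simp: star_def all_edges_def)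
    have "all_edges (insert v (insert u T)) - {{v, u}} \<in> ?X"
      using copyI[OF W(1,2)[OF u]] W(3)[OF u] vu by auto
    moreover have "star v T \<subseteq> all_edges (insert v (insert u T)) - {{v, u}}"
      unfolding W(3)[OF u] using u v T by (auto simp: star_def doubleton_eq_iff)
    moreover have "all_edges (insert v (insert u T)) - {{v, u}} \<subseteq> all_edges V \<union> star v T"
      unfolding W(3)[OF u] using W(4)[OF u] by (auto simp: star_def)
    ultimately show "\<exists>X\<in>?X. star v T \<subseteq> X \<and> X \<subseteq> all_edges V \<union> star v T"
      by (intro bexI conjI)
  next
    fix w assume w: "w \<in> V - T"
    \<comment> \<open>Now the omitted edge \<open>d\<close> is taken inside \<open>T\<close>, so
      that the wanted edge \<open>{v, w}\<close> stays in the copy.\<close>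
    have "2 \<le> card T" using T assms(3) by simp
    then obtain d where d: "d \<subseteq> T" "card d = 2"
      by (rule obtain_subset_with_card_n)
    then have d': "d \<in> all_edges (insert w T)" "d \<noteq> {v, w}"
      using w by (auto simp: all_edges_def)
    then have "all_edges (insert v (insert w T)) - {d} \<in> ?X"
      using copyI[OF W(1,2)[OF w]] W(3)[OF w] by auto
    moreover have "{v, w} \<in> all_edges (insert v (insert w T)) - {d}"
      unfolding W(3)[OF w] using d' by (auto simp: star_def)
    moreover have "all_edges (insert v (insert w T)) - {d} \<subseteq> all_edges V \<union> star v (insert w T)"
      unfolding W(3)[OF w] using W(4)[OF w] by auto
    ultimately show "\<exists>X\<in>?X. {v, w} \<in> X \<and> X \<subseteq> all_edges V \<union> star v (insert w T)"
      by (intro bexI conjI)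
  }
qed

theorem theorem4p3:
  fixes n :: nat
  shows "(n \<ge> 3 \<longrightarrow> unique_maximal_H_matroid (complete_graph 3) n (count_matroid 1 1 n) \<and>
            rank_function_is n (count_matroid 1 1 n) (val_H (complete_graph 3) n)) \<and>
         (n \<ge> 4 \<longrightarrow> unique_maximal_H_matroid (complete_graph 4) n (count_matroid 2 3 n) \<and>
            rank_function_is n (count_matroid 2 3 n) (val_H (complete_graph 4) n)) \<and>
         (n \<ge> 4 \<longrightarrow> unique_maximal_H_matroid (complete_graph_minus_edge 4) n (count_matroid 1 0 n) \<and>
            rank_function_is n (count_matroid 1 0 n) (val_H (complete_graph_minus_edge 4) n)) \<and>
         (n \<ge> 5 \<longrightarrow> unique_maximal_H_matroid (complete_graph_minus_edge 5) n (count_matroid 2 2 n) \<and>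
            rank_function_is n (count_matroid 2 2 n) (val_H (complete_graph_minus_edge 5) n)) \<and>
         (n \<ge> 6 \<longrightarrow> unique_maximal_H_matroid (complete_graph_minus_edge 6) n (count_matroid 3 5 n) \<and>
            rank_function_is n (count_matroid 3 5 n) (val_H (complete_graph_minus_edge 6) n))"
proof -
  have ch: "(2::nat) choose 2 = 1" "(3::nat) choose 2 = 3" "(4::nat) choose 2 = 6"
    "(5::nat) choose 2 = 10" "(6::nat) choose 2 = 15"
    by (simp_all add: choose_two)
  \<comment> \<open>In each of the five cases the complete graphs on fewer vertices than the pattern
    must satisfy the count; there are at most four sizes to check.\<close>
  have small_a: "int (j choose 2) \<le> 1 * int j - 1" if "2 \<le> j" "j < 3" for j
  proof -
    have "j = 2" using that by arith
    then show ?thesis by (simp add: ch)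
  qed
  have small_b: "int (j choose 2) \<le> 2 * int j - 3" if "2 \<le> j" "j < 4" for j
  proof -
    have "j = 2 \<or> j = 3" using that by arith
    then show ?thesis by (elim disjE) (simp_all add: ch)
  qed
  have small_c: "int (j choose 2) \<le> 1 * int j - 0" if "2 \<le> j" "j < 4" for j
  proof -
    have "j = 2 \<or> j = 3" using that by arith
    then show ?thesis by (elim disjE) (simp_all add: ch)
  qed
  have small_d: "int (j choose 2) \<le> 2 * int j - 2" if "2 \<le> j" "j < 5" for j
  proof -
    have "j = 2 \<or> j = 3 \<or> j = 4" using that by arith
    then show ?thesis by (elim disjE) (simp_all add: ch)
  qed
  have small_e: "int (j choose 2) \<le> 3 * int j - 5" if "2 \<le> j" "j < 6" for j
  proof -
    have "j = 2 \<or> j = 3 \<or> j = 4 \<or> j = 5" using that by arith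
    then show ?thesis by (elim disjE) (simp_all add: ch)
  qed
  interpret a: count_H 1 1 n "complete_graph 3" 3 "3 - 1"
    by (rule count_H_complete_graph[OF _ _ _ _ _ small_a]) (simp_all add: ch)
  interpret b: count_H 2 3 n "complete_graph 4" 4 "4 - 1"
    by (rule count_H_complete_graph[OF _ _ _ _ _ small_b]) (simp_all add: ch)
  interpret c: count_H 1 0 n "complete_graph_minus_edge 4" 4 "4 - 2"
    by (rule count_H_complete_graph_minus_edge[OF _ _ _ _ _ small_c]) (simp_all add: ch)
  interpret d: count_H 2 2 n "complete_graph_minus_edge 5" 5 "5 - 2"
    by (rule count_H_complete_graph_minus_edge[OF _ _ _ _ _ small_d]) (simp_all add: ch)
  interpret e: count_H 3 5 n "complete_graph_minus_edge 6" 6 "6 - 2"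
    by (rule count_H_complete_graph_minus_edge[OF _ _ _ _ _ small_e]) (simp_all add: ch)
  show ?thesis
    using a.unique_maximal_count a.rank_function_count b.unique_maximal_count b.rank_function_count
      c.unique_maximal_count c.rank_function_count d.unique_maximal_count d.rank_function_count
      e.unique_maximal_count e.rank_function_count
    by blast
qed

end
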